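(* Let $X$ be a Banach space and let $p,q\in\mathcal{N}(X)$. Then the following statements are equivalent: 1) The norms $p$ and $q$ belong to the same intrinsic part of $\mathcal{N}(X)$. 2) There exist $a,b>0$ such that $a\Delta_p(x,y)\le\Delta_q(x,y)\le b\Delta_p(x,y)$ for every $x,y\in X$.
   Context: $\mathcal{N}(X)$ is the set of all norms on $X$ equivalent to the given norm of the Banach space $X$. The intrinsic order on $\mathcal{N}(X)$ is $u\preceq v$ iff $v-u\in\mathcal{N}(X)\cup\{0\}$. Two norms $p,q\in\mathcal{N}(X)$ belong to the same intrinsic part of $\mathcal{N}(X)$ if there exist $\alpha,\beta>0$ with $\alpha p\preceq q\preceq\beta p$. For $p\in\mathcal{N}(X)$ the triangular defect is $\Delta_p:X\times X\to\mathbb{R}$, $\Delta_p(x,y)=p(x)+p(y)-p(x+y)$. *)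

theory Defs
  imports Complex_Main
begin

definition is_norm :: "('a::real_vector \<Rightarrow> real) \<Rightarrow> bool" where
  "is_norm p \<longleftrightarrow>
     (\<forall>x. 0 \<le> p x) \<and>
     (\<forall>x. p x = 0 \<longleftrightarrow> x = 0) \<and>
     (\<forall>r x. p (r *\<^sub>R x) = \<bar>r\<bar> * p x) \<and>
     (\<forall>x y. p (x + y) \<le> p x + p y)"

definition equivalent_norms ::
    "('a::real_vector \<Rightarrow> real) \<Rightarrow> ('a \<Rightarrow> real) \<Rightarrow> bool" where
  "equivalent_norms p q \<longleftrightarrow>
     (\<exists>c>0. \<exists>C>0. \<forall>x. c * q x \<le> p x \<and> p x \<le> C * q x)"

text \<open>The set $\mathcal{N}(X)$, where $X$ is the type \<open>'a\<close> with its given norm \<open>norm\<close>.\<close>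

definition \<N> :: "('a::real_normed_vector \<Rightarrow> real) set" where
  "\<N> = {p. is_norm p \<and> equivalent_norms p norm}"

text \<open>The intrinsic order. It is meant for arguments in \<open>\<N>\<close>; membership of the
  arguments is not part of the definition.\<close>

definition intrinsic_le ::
    "('a::real_normed_vector \<Rightarrow> real) \<Rightarrow> ('a \<Rightarrow> real) \<Rightarrow> bool"  (infix "\<preceq>" 50) where
  "u \<preceq> v \<longleftrightarrow> (\<lambda>x. v x - u x) \<in> \<N> \<union> {\<lambda>x. 0}"

definition same_intrinsic_part ::
    "('a::real_normed_vector \<Rightarrow> real) \<Rightarrow> ('a \<Rightarrow> real) \<Rightarrow> bool" where
  "same_intrinsic_part p q \<longleftrightarrow>
     (\<exists>\<alpha>>0. \<exists>\<beta>>0. (\<lambda>x. \<alpha> * p x) \<preceq> q \<and> q \<preceq> (\<lambda>x. \<beta> * p x))"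

definition triangular_defect ::
    "('a::real_vector \<Rightarrow> real) \<Rightarrow> 'a \<Rightarrow> 'a \<Rightarrow> real"  ("\<Delta>") where
  "\<Delta> p x y = p x + p y - p (x + y)"

end

theory Submission
  imports Defs
begin

lemma norms_scale:
  assumes "p \<in> \<N>" and "0 < c"
  shows "(\<lambda>x. c * p x) \<in> \<N>"
proof -
  have p: "is_norm p" and "equivalent_norms p norm"
    using assms(1) by (auto simp: \<N>_def)
  then obtain m M where mM: "0 < m" "0 < M" "\<And>x. m * norm x \<le> p x \<and> p x \<le> M * norm x"
    unfolding equivalent_norms_def by blast
  have "is_norm (\<lambda>x. c * p x)"
    using p \<open>0 < c\<close> unfolding is_norm_def
    by (auto simp: distrib_left[symmetric] mult.left_commute)
  moreover have "equivalent_norms (\<lambda>x. c * p x) norm"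
    unfolding equivalent_norms_def
    by (rule exI[of _ "c * m"], rule conjI, use mM \<open>0 < c\<close> in simp,
        rule exI[of _ "c * M"], use mM \<open>0 < c\<close> in \<open>simp add: mult.assoc\<close>)
  ultimately show ?thesis
    by (simp add: \<N>_def)
qed

text \<open>The defect inequality makes \<open>v - u\<close> subadditive, hence nonnegative because it is even,
  but \<open>v - u\<close> may vanish at nonzero vectors. Adding the norm \<open>w\<close> repairs this.\<close>

lemma norms_diff_add:
  assumes "u \<in> \<N>" "v \<in> \<N>" "w \<in> \<N>" and defect: "\<And>x y. \<Delta> u x y \<le> \<Delta> v x y"
  shows "(\<lambda>x. v x - u x + w x) \<in> \<N>"
proof -
  have u: "is_norm u" and v: "is_norm v" and w: "is_norm w"
    and eqv: "equivalent_norms v norm" and eqw: "equivalent_norms w norm"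
    using assms(1-3) by (auto simp: \<N>_def)
  have hom: "u (r *\<^sub>R x) = \<bar>r\<bar> * u x" "v (r *\<^sub>R x) = \<bar>r\<bar> * v x" "w (r *\<^sub>R x) = \<bar>r\<bar> * w x" for r x
    using u v w by (auto simp: is_norm_def)
  have zero: "u 0 = 0" "v 0 = 0" "w 0 = 0"
    using u v w by (auto simp: is_norm_def)
  \<comment> \<open>At the pair \<open>x\<close>, \<open>- x\<close> the sum is zero and both terms
    agree by evenness, so the defects there are \<open>2 * u x\<close> and
    \<open>2 * v x\<close>.\<close>
  have le: "u x \<le> v x" for x
    using defect[of x "- x"] hom[of "-1" x] zero by (simp add: triangular_defect_def)
  have "is_norm (\<lambda>x. v x - u x + w x)"
    unfolding is_norm_def
  proof (intro conjI allI)
    fix x y r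
    have wx: "0 \<le> w x" "w x = 0 \<longleftrightarrow> x = 0" and "w (x + y) \<le> w x + w y"
      using w by (auto simp: is_norm_def)
    then show "v (x + y) - u (x + y) + w (x + y) \<le> v x - u x + w x + (v y - u y + w y)"
      using defect[of x y] by (simp add: triangular_defect_def)
    show "0 \<le> v x - u x + w x"
      using wx le[of x] by simp
    \<comment> \<open>Since \<open>v x - u x\<close> is nonnegative, a vanishing sum forces
      \<open>w x = 0\<close>; definiteness comes from \<open>w\<close> alone.\<close>
    show "v x - u x + w x = 0 \<longleftrightarrow> x = 0"
      using wx le[of x] zero by auto
    show "v (r *\<^sub>R x) - u (r *\<^sub>R x) + w (r *\<^sub>R x) = \<bar>r\<bar> * (v x - u x + w x)"
      by (simp add: hom algebra_simps)
  qed
  moreover have "equivalent_norms (\<lambda>x. v x - u x + w x) norm"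
  proof -
    obtain M where M: "0 < M" "\<And>x. v x \<le> M * norm x"
      using eqv unfolding equivalent_norms_def by blast
    obtain k K where K: "0 < k" "0 < K" "\<And>x. k * norm x \<le> w x" "\<And>x. w x \<le> K * norm x"
      using eqw unfolding equivalent_norms_def by blast
    have "k * norm x \<le> v x - u x + w x \<and> v x - u x + w x \<le> (M + K) * norm x" for x
    proof -
      have "0 \<le> u x"
        using u by (simp add: is_norm_def)
      then show ?thesis
        using le[of x] M(2)[of x] K(3,4)[of x] by (simp add: distrib_right)
    qed
    moreover have "0 < M + K"
      using M K by simp
    ultimately show ?thesis
      unfolding equivalent_norms_def using K(1) by blast
  qed
  ultimately show ?thesis
    by (simp add: \<N>_def)
qed

text \<open>After rearranging, the claim is exactly subadditivity of \<open>v - u\<close>. This is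
  the triangle inequality if \<open>v - u\<close> is a norm and trivial if it is zero, so both cases
  of the order are covered.\<close>

lemma intrinsic_le_imp_defect_le:
  assumes "u \<preceq> v"
  shows "\<Delta> u x y \<le> \<Delta> v x y"
proof -
  have "v (x + y) - u (x + y) \<le> (v x - u x) + (v y - u y)"
    using assms unfolding intrinsic_le_def
  proof
    assume "(\<lambda>x. v x - u x) \<in> \<N>"
    then show ?thesis
      by (simp add: \<N>_def is_norm_def)
  next
    assume "(\<lambda>x. v x - u x) \<in> {\<lambda>x. 0}"
    then have "v z - u z = 0" for z
      by (auto dest: fun_cong)
    then show ?thesis
      by simp
  qed
  then show ?thesis
    by (simp add: triangular_defect_def)
qed

lemma triangular_defect_scale: "\<Delta> (\<lambda>x. c * p x) x y = c * \<Delta> p x y"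
  by (simp add: triangular_defect_def algebra_simps)

theorem theorem4p6:
  fixes p q :: "'a::banach \<Rightarrow> real"
  assumes "p \<in> \<N>" and "q \<in> \<N>"
  shows "same_intrinsic_part p q \<longleftrightarrow>
    (\<exists>a>0. \<exists>b>0. \<forall>x y. a * \<Delta> p x y \<le> \<Delta> q x y \<and> \<Delta> q x y \<le> b * \<Delta> p x y)"
proof
  assume "same_intrinsic_part p q"
  then obtain a b where "0 < a" "0 < b" "(\<lambda>x. a * p x) \<preceq> q" "q \<preceq> (\<lambda>x. b * p x)"
    unfolding same_intrinsic_part_def by blast
  \<comment> \<open>The same constants serve: each order relation gives a defect inequality, and the
    scalar comes out of \<Delta>.\<close>
  then show "\<exists>a>0. \<exists>b>0. \<forall>x y. a * \<Delta> p x y \<le> \<Delta> q x y \<and> \<Delta> q x y \<le> b * \<Delta> p x y"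
    by (metis intrinsic_le_imp_defect_le triangular_defect_scale)
next
  assume "\<exists>a>0. \<exists>b>0. \<forall>x y. a * \<Delta> p x y \<le> \<Delta> q x y \<and> \<Delta> q x y \<le> b * \<Delta> p x y"
  then obtain a b where ab: "0 < a" "0 < b"
    and lower: "\<And>x y. a * \<Delta> p x y \<le> \<Delta> q x y"
    and upper: "\<And>x y. \<Delta> q x y \<le> b * \<Delta> p x y"
    by blast
  \<comment> \<open>The difference \<open>q - a * p\<close> might be degenerate, so half of the
    subtracted multiple of \<open>p\<close> is given back. The sum is
    \<open>q - (a / 2) * p\<close>, whose coefficient is still positive.\<close>
  have "(\<lambda>x. q x - a * p x + (a / 2) * p x) \<in> \<N>"
    using assms ab lower
    by (intro norms_diff_add norms_scale) (auto simp: triangular_defect_scale)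
  then have "(\<lambda>x. (a / 2) * p x) \<preceq> q"
    by (simp add: intrinsic_le_def)
  \<comment> \<open>Here the repairing norm is \<open>b * p\<close> itself, which enlarges the upper
    constant from \<open>b\<close> to \<open>2 * b\<close>.\<close>
  moreover have "(\<lambda>x. b * p x - q x + b * p x) \<in> \<N>"
    using assms ab upper
    by (intro norms_diff_add norms_scale) (auto simp: triangular_defect_scale)
  then have "q \<preceq> (\<lambda>x. (2 * b) * p x)"
    by (simp add: intrinsic_le_def algebra_simps)
  ultimately show "same_intrinsic_part p q"
    unfolding same_intrinsic_part_def using ab
    by (intro exI[of _ "a / 2"] exI[of _ "2 * b"] conjI) auto
qed

end
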